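(* Let $c>0$ be fixed. Suppose $\{a_1, \dots, a_n\} \subset \mathbb{R}_{>0}$, with largest element $a_n$, has $1$-separated subset sums and satisfies $$a_n^2 \leq c \cdot n^{-1/2} \sum_{i=1}^{n} a_i^2.$$ Then, as $n \rightarrow \infty$, $$\int_{\mathbb{R}} \left( (h*\mu)(x) - \gamma(x) \right)^2 dx = \int_{|x| \geq \frac{1}{4a_n}} \left( \frac{\sin(2\pi x)}{2\pi x} \right)^2 \prod_{i=1}^{n} \bigl(\cos( 2\pi a_i x)\bigr)^2 dx +o(2^{-n}).$$ That is: for every $c>0$ and every $\eta > 0$ there is an $N$ such that for all $n \geq N$ and all such sets $\{a_1,\dots,a_n\}$, the absolute value of the difference of the two integrals is at most $\eta \cdot 2^{-n}$.
   Context: The set $\{a_1,\dots,a_n\}\subset\mathbb{R}_{>0}$ has $1$-separated subset sums if for any two distinct subsets $S,T \subseteq \{1,\dots,n\}$ (the empty set allowed, with sum $0$) one has $\left|\sum_{i\in S} a_i - \sum_{i \in T} a_i\right| \geq 1$. The elements are ordered so that $a_n = \max_i a_i$. Given $\{a_1,\dots,a_n\}$: let $\mu$ be the probability measure on $\mathbb{R}$ which is the distribution of the random variable $X = \sum_{i=1}^{n} \varepsilon_i a_i$, where $\varepsilon_1,\dots,\varepsilon_n$ are independent and each uniformly distributed on $\{-1,1\}$; so $\mu = \frac{1}{2^n}\sum_{\varepsilon \in \{-1,1\}^n} \delta_{\varepsilon_1 a_1 + \dots + \varepsilon_n a_n}$. Let $h(x) = \frac12 \chi_{[-1,1]}(x)$,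 where $\chi$ denotes the characteristic (indicator) function. Then $h * \mu$ is the probability density $$(h*\mu)(x) = \frac{1}{2^n} \sum_{j=1}^{2^n} \frac12 \chi_{[x_j-1,x_j+1]}(x),$$ where $x_1,\dots,x_{2^n}$ are the $2^n$ outcomes $\varepsilon_1 a_1 + \dots + \varepsilon_n a_n$. Finally, $\gamma$ is the centered Gaussian density with variance $\sum_{i=1}^n a_i^2$: $$ \gamma(x) = \frac{1}{\sqrt{2\pi}} \left( \sum_{i=1}^{n} a_i^2 \right)^{-1/2} \exp\left( -\frac{x^2}{2} \left( \sum_{i=1}^{n} a_i^2 \right)^{-1}\right).$$ *)

theory Defs
  imports "HOL-Probability.Probability" "HOL-Probability.Product_PMF"
begin

text \<open>The numbers \<open>a\<^sub>1, \<dots>, a\<^sub>n\<close> are the values \<open>a 1, \<dots>, a n\<close> of a function \<open>a :: nat \<Rightarrow> real\<close>;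
  its other values play no role. Distinctness of these numbers need not be assumed: it is the case
  of singleton \<open>S\<close> and \<open>T\<close> in the following definition.\<close>

definition one_separated_subset_sums :: "nat \<Rightarrow> (nat \<Rightarrow> real) \<Rightarrow> bool" where
  "one_separated_subset_sums n a \<longleftrightarrow>
     (\<forall>S T. S \<subseteq> {1..n} \<longrightarrow> T \<subseteq> {1..n} \<longrightarrow> S \<noteq> T \<longrightarrow>
        \<bar>(\<Sum>i\<in>S. a i) - (\<Sum>i\<in>T. a i)\<bar> \<ge> 1)"

definition sign_sum_distr :: "nat \<Rightarrow> (nat \<Rightarrow> real) \<Rightarrow> real pmf" where
  "sign_sum_distr n a =
     map_pmf (\<lambda>\<epsilon>. \<Sum>i=1..n. \<epsilon> i * a i) (Pi_pmf {1..n} 0 (\<lambda>_. pmf_of_set {-1, 1}))"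

definition box_kernel :: "real \<Rightarrow> real" where
  "box_kernel x = 1 / 2 * indicator {-1..1} x"

definition convolve_pmf :: "(real \<Rightarrow> real) \<Rightarrow> real pmf \<Rightarrow> real \<Rightarrow> real" where
  "convolve_pmf f p x = measure_pmf.expectation p (\<lambda>y. f (x - y))"

definition gaussian_approx :: "nat \<Rightarrow> (nat \<Rightarrow> real) \<Rightarrow> real \<Rightarrow> real" where
  "gaussian_approx n a = normal_density 0 (sqrt (\<Sum>i=1..n. (a i)\<^sup>2))"

lemma sign_sum_distr_altdef:
  "sign_sum_distr n a =
     map_pmf (\<lambda>\<epsilon>. \<Sum>i=1..n. \<epsilon> i * a i) (pmf_of_set (PiE_dflt {1..n} 0 (\<lambda>_. {-1, 1})))"
  unfolding sign_sum_distr_def by (subst Pi_pmf_of_set) auto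

lemma convolve_box_kernel_sign_sum_distr:
  "convolve_pmf box_kernel (sign_sum_distr n a) x =
     1 / 2 ^ n * (\<Sum>\<epsilon>\<in>PiE_dflt {1..n} 0 (\<lambda>_. {-1, 1}).
       1 / 2 * indicator {(\<Sum>i=1..n. \<epsilon> i * a i) - 1..(\<Sum>i=1..n. \<epsilon> i * a i) + 1} x)"
proof -
  let ?E = "PiE_dflt {1..n} (0::real) (\<lambda>_. {-1, 1})"
  have fin: "finite ?E" by (rule finite_PiE_dflt) auto
  have ne: "?E \<noteq> {}" by (subst PiE_dflt_empty_iff) auto
  have card: "card ?E = 2 ^ n"
    by (subst card_PiE_dflt) (auto simp: numeral_2_eq_2)
  have box: "box_kernel (x - y) = 1 / 2 * indicator {y - 1..y + 1} x" for y
    by (auto simp: box_kernel_def indicator_def)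
  show ?thesis
    unfolding convolve_pmf_def sign_sum_distr_altdef integral_map_pmf box
      integral_pmf_of_set[OF ne fin] card
    by simp
qed

lemma gaussian_approx_altdef:
  "gaussian_approx n a x =
     1 / sqrt (2 * pi) * (\<Sum>i=1..n. (a i)\<^sup>2) powr (-1 / 2) *
     exp (- (x\<^sup>2 / 2) * inverse (\<Sum>i=1..n. (a i)\<^sup>2))"
proof -
  have "(\<Sum>i=1..n. (a i)\<^sup>2) \<ge> 0" by (rule sum_nonneg) simp
  then show ?thesis
    by (auto simp: gaussian_approx_def normal_density_def real_sqrt_mult powr_minus powr_half_sqrt
          field_simps)
qed

end

theory Submission
  imports Defs
begin

text \<open>
  Write \<open>\<sigma>\<^sup>2\<close> for the sum of the \<open>a\<^sub>i\<^sup>2\<close> and \<open>M\<close> for the largest \<open>a\<^sub>i\<close>. By Parseval, the \<open>L\<^sup>2\<close>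
  distance is the integral of \<open>(S P - G)\<^sup>2\<close>, where \<open>S x = sin (2 \<pi> x) / (2 \<pi> x)\<close>, \<open>P\<close> is the product of
  the cosines and \<open>G\<close> is the Fourier transform of the Gaussian. For \<open>\<bar>x\<bar> < 1 / (4 M)\<close> all arguments of the
  cosines are at most \<open>\<pi> / 2\<close> in modulus, so \<open>cos y \<le> exp (- y\<^sup>2 / 2)\<close> gives \<open>0 \<le> S P \<le> G\<close>, while a
  fourth order estimate of \<open>cos y - exp (- y\<^sup>2 / 2)\<close> shows that \<open>S P - G\<close> is small. For
  \<open>\<bar>x\<bar> \<ge> 1 / (4 M)\<close> the terms involving \<open>G\<close> are at most \<open>3 G \<le> 48 M\<^sup>2 x\<^sup>2 G\<close>. In both ranges the error is
  thus dominated by \<open>G\<close> times a polynomial, and Gaussian moments bound its integral by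
  \<open>M\<^sup>2 / \<sigma>\<^sup>3 \<le> c / (\<surd>n \<sigma>)\<close>. Finally \<open>\<sigma> \<ge> 2\<^sup>n / 8\<close>: the signed sums are \<open>2\<close>-separated, and by Chebyshev's
  inequality most of them lie in \<open>[-2 \<sigma>, 2 \<sigma>]\<close>.
\<close>

section \<open>Parseval's identity\<close>

lemma integrable_times_bounded:
  fixes f g :: "'a \<Rightarrow> real"
  assumes "integrable M f" "g \<in> borel_measurable M" "\<And>x. \<bar>g x\<bar> \<le> B"
  shows "integrable M (\<lambda>x. f x * g x)"
proof (rule Bochner_Integration.integrable_bound)
  show "integrable M (\<lambda>x. B * f x)"
    using assms(1) by simp
  show "AE x in M. norm (f x * g x) \<le> norm (B * f x)"
  proof (rule AE_I2)
    fix x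
    have "\<bar>f x\<bar> * \<bar>g x\<bar> \<le> \<bar>f x\<bar> * \<bar>B\<bar>"
      using assms(3)[of x] by (intro mult_left_mono) auto
    then show "norm (f x * g x) \<le> norm (B * f x)"
      by (simp add: abs_mult mult.commute)
  qed
qed (use assms in measurable)

lemma integrable_scaleR_cis:
  fixes f g :: "real \<Rightarrow> real"
  assumes "integrable lborel f" and [measurable]: "g \<in> borel_measurable borel"
  shows "integrable lborel (\<lambda>x. f x *\<^sub>R cis (g x))"
proof (rule Bochner_Integration.integrable_bound)
  show "integrable lborel f" by fact
  note borel_measurable_integrable[OF assms(1), measurable]
  show "(\<lambda>x. f x *\<^sub>R cis (g x)) \<in> borel_measurable lborel"
    unfolding cis_conv_exp by measurable
qed auto

text \<open>The product \<open>w \<xi> * g x\<close> is integrable on the plane and stays so after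
  multiplication by a bounded measurable kernel, so Fubini applies. It serves twice for Parseval:
  with a cosine kernel, and with a kernel that is itself an integral.\<close>

lemma Fubini_bounded_kernel:
  fixes w g :: "real \<Rightarrow> real" and K :: "real \<Rightarrow> real \<Rightarrow> real"
  assumes w: "integrable lborel w" and g: "integrable lborel g"
    and K: "case_prod K \<in> borel_measurable (borel \<Otimes>\<^sub>M borel)"
    and B: "\<And>\<xi> x. \<bar>K \<xi> x\<bar> \<le> B"
  shows "(LINT \<xi>|lborel. w \<xi> * (LINT x|lborel. g x * K \<xi> x)) =
    (LINT x|lborel. g x * (LINT \<xi>|lborel. w \<xi> * K \<xi> x))"
proof -
  note [measurable] = borel_measurable_integrable[OF w] borel_measurable_integrable[OF g]
  have K'[measurable]: "case_prod K \<in> borel_measurable (lborel \<Otimes>\<^sub>M lborel)"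
    using K by measurable
  have "integrable (lborel \<Otimes>\<^sub>M lborel) (\<lambda>(\<xi>, x). w \<xi> * g x)"
    by (rule lborel_pair.Fubini_integrable)
       (use w g in \<open>auto simp: abs_mult\<close>)
  from integrable_times_bounded[OF this K'] B
  have "integrable (lborel \<Otimes>\<^sub>M lborel) (\<lambda>p. (case p of (\<xi>, x) \<Rightarrow> w \<xi> * g x) * case_prod K p)"
    by (auto simp: split_beta)
  then have int: "integrable (lborel \<Otimes>\<^sub>M lborel) (\<lambda>(\<xi>, x). w \<xi> * g x * K \<xi> x)"
    by (simp add: split_beta')
  have "(LINT \<xi>|lborel. w \<xi> * (LINT x|lborel. g x * K \<xi> x)) =
      (LINT \<xi>|lborel. LINT x|lborel. w \<xi> * g x * K \<xi> x)"
    by (simp add: mult.assoc)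
  also have "\<dots> = (LINT x|lborel. LINT \<xi>|lborel. w \<xi> * g x * K \<xi> x)"
    using lborel_pair.Fubini_integral[OF int] by simp
  also have "\<dots> = (LINT x|lborel. LINT \<xi>|lborel. g x * (w \<xi> * K \<xi> x))"
    by (simp add: mult_ac)
  finally show ?thesis by simp
qed

section \<open>Fourier transforms of Gaussian densities and weights\<close>

lemma normal_density_rescale:
  assumes "\<sigma> > 0"
  shows "\<sigma> * normal_density 0 \<sigma> (\<sigma> * x) = std_normal_density x"
  using assms by (simp add: normal_density_def power_mult_distrib real_sqrt_mult)

lemma integral_normal_density_cis:
  assumes "\<sigma> > 0"
  shows "(CLINT x|lborel. normal_density 0 \<sigma> x *\<^sub>R cis (t * x)) = of_real (exp (- (\<sigma> * t)\<^sup>2 / 2))"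
proof -
  have "(CLINT x|lborel. normal_density 0 \<sigma> x *\<^sub>R cis (t * x)) =
      \<sigma> *\<^sub>R (CLINT x|lborel. normal_density 0 \<sigma> (\<sigma> * x) *\<^sub>R cis (t * (\<sigma> * x)))"
    using assms by (subst lborel_integral_real_affine[where c = \<sigma> and t = 0]) auto
  also have "\<dots> = (CLINT x|lborel. (\<sigma> * normal_density 0 \<sigma> (\<sigma> * x)) *\<^sub>R cis (t * (\<sigma> * x)))"
    by (subst integral_scaleR_right[symmetric]) (simp_all add: mult.assoc)
  also have "\<dots> = (CLINT x|lborel. std_normal_density x *\<^sub>R iexp ((\<sigma> * t) * x))"
    unfolding normal_density_rescale[OF assms] by (simp add: cis_conv_exp mult_ac)
  also have "\<dots> = char std_normal_distribution (\<sigma> * t)"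
    unfolding char_def by (subst integral_density) (auto simp: normal_density_nonneg)
  finally show ?thesis
    by (simp add: char_std_normal_distribution)
qed

lemma integral_normal_density_cos:
  assumes "\<sigma> > 0"
  shows "(LINT x|lborel. normal_density 0 \<sigma> x * cos (t * x)) = exp (- (\<sigma> * t)\<^sup>2 / 2)"
proof -
  have "(LINT x|lborel. normal_density 0 \<sigma> x * cos (t * x)) =
      (LINT x|lborel. Re (normal_density 0 \<sigma> x *\<^sub>R cis (t * x)))"
    by simp
  also have "\<dots> = Re (CLINT x|lborel. normal_density 0 \<sigma> x *\<^sub>R cis (t * x))"
    using assms by (intro integral_Re integrable_scaleR_cis) auto
  finally show ?thesis
    using integral_normal_density_cis[OF assms] by simp
qed

text \<open>Recognising the frequency weight as a multiple of a normal density with the dual width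
  makes integrability, cosine transform and moments available from facts about normal
  densities.\<close>

lemma gaussian_weight_eq_normal_density:
  assumes "\<sigma> > 0"
  shows "exp (- 2 * pi\<^sup>2 * \<sigma>\<^sup>2 * \<xi>\<^sup>2) =
    1 / (sqrt (2 * pi) * \<sigma>) * normal_density 0 (1 / (2 * pi * \<sigma>)) \<xi>"
proof -
  have "1 / sqrt (2 * pi * (1 / (2 * pi * \<sigma>))\<^sup>2) = sqrt (2 * pi) * \<sigma>"
  proof -
    have "sqrt (2 * pi * (1 / (2 * pi * \<sigma>))\<^sup>2) = sqrt (2 * pi) * (1 / (2 * pi * \<sigma>))"
      using assms by (simp add: real_sqrt_mult)
    moreover have "2 * pi = sqrt (2 * pi) * sqrt (2 * pi)" by simp
    ultimately show ?thesis
      using assms by (smt (verit) divide_divide_eq_right mult.assoc mult.commute mult.left_neutral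
        nonzero_mult_div_cancel_left real_sqrt_gt_zero pi_gt_zero times_divide_eq_right)
  qed
  moreover have "- (\<xi> - 0)\<^sup>2 / (2 * (1 / (2 * pi * \<sigma>))\<^sup>2) = - 2 * pi\<^sup>2 * \<sigma>\<^sup>2 * \<xi>\<^sup>2"
    using assms by (simp add: field_simps power2_eq_square)
  ultimately show ?thesis
    using assms unfolding normal_density_def by simp
qed

lemma integrable_gaussian_weight:
  "\<sigma> > 0 \<Longrightarrow> integrable lborel (\<lambda>\<xi>. exp (- 2 * pi\<^sup>2 * \<sigma>\<^sup>2 * \<xi>\<^sup>2))"
  unfolding gaussian_weight_eq_normal_density by simp

text \<open>Since the weight has dual width 1 / (2 pi \<sigma>), its cosine transform is a Gaussian
  of width \<sigma>. As \<sigma> tends to 0, these densities form the approximate identity used for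
  Parseval.\<close>

lemma integral_gaussian_weight_cos:
  assumes "\<sigma> > 0"
  shows "(LINT \<xi>|lborel. exp (- 2 * pi\<^sup>2 * \<sigma>\<^sup>2 * \<xi>\<^sup>2) * cos (2 * pi * \<xi> * u)) = normal_density 0 \<sigma> u"
proof -
  have "(LINT \<xi>|lborel. exp (- 2 * pi\<^sup>2 * \<sigma>\<^sup>2 * \<xi>\<^sup>2) * cos (2 * pi * \<xi> * u)) =
      (LINT \<xi>|lborel. 1 / (sqrt (2 * pi) * \<sigma>) *
        (normal_density 0 (1 / (2 * pi * \<sigma>)) \<xi> * cos ((2 * pi * u) * \<xi>)))"
    unfolding gaussian_weight_eq_normal_density[OF assms] by (simp add: mult_ac)
  also have "\<dots> = 1 / (sqrt (2 * pi) * \<sigma>) * exp (- (1 / (2 * pi * \<sigma>) * (2 * pi * u))\<^sup>2 / 2)"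
    using assms by (subst integral_mult_right_zero, subst integral_normal_density_cos) auto
  also have "\<dots> = normal_density 0 \<sigma> u"
    using assms by (simp add: normal_density_def real_sqrt_mult power_divide mult.commute)
  finally show ?thesis .
qed

text \<open>The frequency side is damped by a Gaussian weight, which on the other side replaces one factor
  \<open>f\<close> by a Gaussian average of \<open>f\<close> at scale \<open>\<epsilon>\<close>; then \<open>\<epsilon> \<rightarrow> 0\<close>. The continuity assumption makes
  the averages converge almost everywhere.\<close>

lemma
  fixes f :: "real \<Rightarrow> real"
  assumes int: "integrable lborel f"
    and bdd: "\<And>x. \<bar>f x\<bar> \<le> B"
    and cont: "AE x in lborel. isCont f x"
  defines "F \<equiv> \<lambda>\<xi>. CLINT x|lborel. f x *\<^sub>R cis (2 * pi * \<xi> * x)"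
  shows Parseval_integrable: "integrable lborel (\<lambda>\<xi>. (cmod (F \<xi>))\<^sup>2)"
    and Parseval: "(LINT \<xi>|lborel. (cmod (F \<xi>))\<^sup>2) = (LINT x|lborel. (f x)\<^sup>2)"
proof -
  note [measurable] = borel_measurable_integrable[OF int]
  \<comment> \<open>The real and imaginary parts of \<open>F\<close> are treated as real integrals,
    so that Fubini and the convergence theorems are applied to real functions only.\<close>
  define C where "C \<xi> = (LINT x|lborel. f x * cos (2 * pi * \<xi> * x))" for \<xi>
  define S where "S \<xi> = (LINT x|lborel. f x * sin (2 * pi * \<xi> * x))" for \<xi>
  define L where "L = (LINT x|lborel. \<bar>f x\<bar>)"
  have C_meas[measurable]: "C \<in> borel_measurable borel"
    unfolding C_def by measurable
  have S_meas[measurable]: "S \<in> borel_measurable borel"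
    unfolding S_def by measurable
  have int_cos: "integrable lborel (\<lambda>x. f x * cos (g x))" and
    int_sin: "integrable lborel (\<lambda>x. f x * sin (g x))"
    if [measurable]: "g \<in> borel_measurable borel" for g
    by (rule integrable_times_bounded[OF int, where B = 1]; simp)+
  have F_eq: "F \<xi> = Complex (C \<xi>) (S \<xi>)" for \<xi>
  proof (rule complex_eqI)
    have *: "integrable lborel (\<lambda>x. f x *\<^sub>R cis (2 * pi * \<xi> * x))"
      by (rule integrable_scaleR_cis[OF int]) simp
    show "Re (F \<xi>) = Re (Complex (C \<xi>) (S \<xi>))"
      unfolding F_def integral_Re[OF *, symmetric] by (simp add: C_def)
    show "Im (F \<xi>) = Im (Complex (C \<xi>) (S \<xi>))"
      unfolding F_def integral_Im[OF *, symmetric] by (simp add: S_def)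
  qed
  have L_bound: "\<bar>LINT x|lborel. f x * g x\<bar> \<le> L"
    if [measurable]: "g \<in> borel_measurable borel" and "\<And>x. \<bar>g x\<bar> \<le> 1" for g :: "real \<Rightarrow> real"
  proof -
    have "\<bar>LINT x|lborel. f x * g x\<bar> \<le> (LINT x|lborel. \<bar>f x * g x\<bar>)"
      by (rule integral_abs_bound)
    also have "\<dots> \<le> L"
      unfolding L_def
    proof (rule integral_mono)
      show "integrable lborel (\<lambda>x. \<bar>f x * g x\<bar>)"
        by (intro integrable_abs integrable_times_bounded[OF int, where B = 1]) (use that in auto)
      show "\<bar>f x * g x\<bar> \<le> \<bar>f x\<bar>" for x
        using that(2)[of x] by (simp add: abs_mult mult_left_le)
    qed (use int in auto)
    finally show ?thesis .
  qed
  have inner: "C \<xi> * cos (2 * pi * \<xi> * x) + S \<xi> * sin (2 * pi * \<xi> * x) =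
      (LINT y|lborel. f y * cos (2 * pi * \<xi> * (x - y)))" for \<xi> x
  proof -
    have "(LINT y|lborel. f y * cos (2 * pi * \<xi> * (x - y))) =
        (LINT y|lborel. (f y * cos (2 * pi * \<xi> * y)) * cos (2 * pi * \<xi> * x) +
          (f y * sin (2 * pi * \<xi> * y)) * sin (2 * pi * \<xi> * x))"
      by (simp add: right_diff_distrib cos_diff distrib_left mult_ac)
    also have "\<dots> = C \<xi> * cos (2 * pi * \<xi> * x) + S \<xi> * sin (2 * pi * \<xi> * x)"
      unfolding C_def S_def by (subst Bochner_Integration.integral_add) (auto intro!: int_cos int_sin)
    finally show ?thesis ..
  qed
  \<comment> \<open>Here |F|^2 becomes a double integral of f(x) f(y) with a kernel depending on x -
    y. Once the weight is present, the integration over \<xi> can be carried out first.\<close>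
  have outer: "(cmod (F \<xi>))\<^sup>2 = (LINT x|lborel. f x * (LINT y|lborel. f y * cos (2 * pi * \<xi> * (x - y))))" for \<xi>
  proof -
    have "(LINT x|lborel. f x * (LINT y|lborel. f y * cos (2 * pi * \<xi> * (x - y)))) =
        (LINT x|lborel. C \<xi> * (f x * cos (2 * pi * \<xi> * x)) + S \<xi> * (f x * sin (2 * pi * \<xi> * x)))"
      unfolding inner[symmetric] by (simp add: algebra_simps)
    also have "\<dots> = C \<xi> * C \<xi> + S \<xi> * S \<xi>"
      by (subst Bochner_Integration.integral_add) (auto intro!: int_cos int_sin simp: C_def S_def)
    finally show ?thesis
      unfolding F_eq cmod_power2 by (simp add: power2_eq_square)
  qed
  define \<epsilon> where "\<epsilon> k = 1 / real (Suc k)" for k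
  have \<epsilon>_pos: "\<epsilon> k > 0" for k by (simp add: \<epsilon>_def)
  have \<epsilon>_lim: "\<epsilon> \<longlonglongrightarrow> 0"
    unfolding \<epsilon>_def using LIMSEQ_inverse_real_of_nat by (simp add: inverse_eq_divide)
  define w where "w k \<xi> = exp (- 2 * pi\<^sup>2 * (\<epsilon> k)\<^sup>2 * \<xi>\<^sup>2)" for k \<xi>
  have w_int: "integrable lborel (w k)" for k
    unfolding w_def by (rule integrable_gaussian_weight[OF \<epsilon>_pos])
  \<comment> \<open>Scaling the Gaussian average to the standard density leaves \<open>k\<close>
    only in the argument of \<open>f\<close>, so one dominating function works for all
    \<open>k\<close>.\<close>
  define f\<epsilon> where "f\<epsilon> k x = (LINT z|lborel. std_normal_density z * f (x + \<epsilon> k * z))" for k x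
  have smooth: "(LINT \<xi>|lborel. w k \<xi> * (LINT y|lborel. f y * cos (2 * pi * \<xi> * (x - y)))) = f\<epsilon> k x" for k x
  proof -
    have "(LINT \<xi>|lborel. w k \<xi> * (LINT y|lborel. f y * cos (2 * pi * \<xi> * (x - y)))) =
        (LINT y|lborel. f y * (LINT \<xi>|lborel. w k \<xi> * cos (2 * pi * \<xi> * (x - y))))"
      by (rule Fubini_bounded_kernel[OF w_int int, where B = 1]) auto
    also have "\<dots> = (LINT y|lborel. f y * normal_density 0 (\<epsilon> k) (x - y))"
      unfolding w_def integral_gaussian_weight_cos[OF \<epsilon>_pos] ..
    also have "\<dots> = (LINT z|lborel. f (x + \<epsilon> k * z) * (\<epsilon> k * normal_density 0 (\<epsilon> k) (- (\<epsilon> k * z))))"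
      using \<epsilon>_pos[of k]
      by (subst lborel_integral_real_affine[where c = "\<epsilon> k" and t = x])
         (auto simp flip: integral_mult_right_zero simp: mult_ac)
    also have "\<dots> = f\<epsilon> k x"
      unfolding f\<epsilon>_def normal_density_rescale[OF \<epsilon>_pos, of k, symmetric]
      by (simp add: normal_density_def mult.commute)
    finally show ?thesis .
  qed
  have regular: "(LINT \<xi>|lborel. w k \<xi> * (cmod (F \<xi>))\<^sup>2) = (LINT x|lborel. f x * f\<epsilon> k x)" for k
    unfolding outer smooth[symmetric]
  proof (rule Fubini_bounded_kernel[OF w_int int, where B = L])
    show "\<bar>LINT y|lborel. f y * cos (2 * pi * \<xi> * (x - y))\<bar> \<le> L" for \<xi> x
      by (rule L_bound) auto
  qed measurable
  have f\<epsilon>_meas[measurable]: "f\<epsilon> k \<in> borel_measurable borel" for k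
    unfolding f\<epsilon>_def by measurable
  have std_bound: "\<bar>std_normal_density z * f y\<bar> \<le> B * std_normal_density z" for z y
    using bdd[of y] by (simp add: abs_mult mult.commute mult_right_mono)
  have f\<epsilon>_bound: "\<bar>f\<epsilon> k x\<bar> \<le> B" for k x
  proof -
    have "\<bar>f\<epsilon> k x\<bar> \<le> (LINT z|lborel. B * std_normal_density z)"
      unfolding f\<epsilon>_def
      by (rule order_trans[OF integral_abs_bound], rule integral_mono)
         (auto intro!: integrable_abs integrable_times_bounded[where B = B] bdd std_bound)
    then show ?thesis by simp
  qed
  have f\<epsilon>_lim: "(\<lambda>k. f\<epsilon> k x) \<longlonglongrightarrow> f x" if "isCont f x" for x
  proof -
    have "(\<lambda>k. f\<epsilon> k x) \<longlonglongrightarrow> (LINT z|lborel. std_normal_density z * f x)"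
      unfolding f\<epsilon>_def
    proof (rule integral_dominated_convergence[where w = "\<lambda>z. B * std_normal_density z"])
      show "AE z in lborel. (\<lambda>k. std_normal_density z * f (x + \<epsilon> k * z)) \<longlonglongrightarrow> std_normal_density z * f x"
      proof (rule AE_I2)
        fix z
        have "(\<lambda>k. x + \<epsilon> k * z) \<longlonglongrightarrow> x + 0 * z"
          by (intro tendsto_intros \<epsilon>_lim)
        then have "(\<lambda>k. f (x + \<epsilon> k * z)) \<longlonglongrightarrow> f x"
          using isCont_tendsto_compose[OF that] by simp
        then show "(\<lambda>k. std_normal_density z * f (x + \<epsilon> k * z)) \<longlonglongrightarrow> std_normal_density z * f x"
          by (intro tendsto_intros)
      qed
    qed (use std_bound in auto)
    then show ?thesis by simp
  qed
  \<comment> \<open>The limit is computed on the space side, where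
    \<open>B * \<bar>f x\<bar>\<close> dominates.\<close>
  have lim: "(\<lambda>k. LINT \<xi>|lborel. w k \<xi> * (cmod (F \<xi>))\<^sup>2) \<longlonglongrightarrow> (LINT x|lborel. (f x)\<^sup>2)"
    unfolding regular unfolding power2_eq_square
  proof (rule integral_dominated_convergence[where w = "\<lambda>x. B * \<bar>f x\<bar>"])
    show "AE x in lborel. (\<lambda>k. f x * f\<epsilon> k x) \<longlonglongrightarrow> f x * f x"
      using cont by eventually_elim (intro tendsto_intros f\<epsilon>_lim)
    show "AE x in lborel. norm (f x * f\<epsilon> k x) \<le> B * \<bar>f x\<bar>" for k
    proof (rule AE_I2)
      fix x
      have "\<bar>f x\<bar> * \<bar>f\<epsilon> k x\<bar> \<le> \<bar>f x\<bar> * B"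
        by (rule mult_left_mono[OF f\<epsilon>_bound abs_ge_zero])
      then show "norm (f x * f\<epsilon> k x) \<le> B * \<bar>f x\<bar>"
        by (simp add: abs_mult mult.commute)
    qed
  qed (use int in auto)
  have F_meas[measurable]: "(\<lambda>\<xi>. (cmod (F \<xi>))\<^sup>2) \<in> borel_measurable lborel"
    unfolding F_eq cmod_power2 by simp
  have F_bound: "\<bar>(cmod (F \<xi>))\<^sup>2\<bar> \<le> 2 * L\<^sup>2" for \<xi>
  proof -
    have "\<bar>C \<xi>\<bar> \<le> L" "\<bar>S \<xi>\<bar> \<le> L"
      unfolding C_def S_def by (rule L_bound; simp)+
    then have "(C \<xi>)\<^sup>2 \<le> L\<^sup>2" "(S \<xi>)\<^sup>2 \<le> L\<^sup>2"
      by (simp_all add: abs_le_square_iff[symmetric])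
    then show ?thesis unfolding F_eq cmod_power2 by simp
  qed
  have 1: "integrable lborel (\<lambda>\<xi>. w k \<xi> * (cmod (F \<xi>))\<^sup>2)" for k
    by (rule integrable_times_bounded[OF w_int F_meas F_bound])
  \<comment> \<open>On the frequency side the weights increase to 1. Monotone convergence yields the
    integrability of |F|^2 along with its integral; a dominating function would presuppose that
    integrability.\<close>
  have 2: "AE \<xi> in lborel. mono (\<lambda>k. w k \<xi> * (cmod (F \<xi>))\<^sup>2)"
  proof (intro AE_I2 monoI mult_right_mono)
    fix \<xi> :: real and j k :: nat
    assume "j \<le> k"
    then have "(\<epsilon> k)\<^sup>2 \<le> (\<epsilon> j)\<^sup>2"
      unfolding \<epsilon>_def by (intro power_mono frac_le) auto
    then show "w j \<xi> \<le> w k \<xi>"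
      unfolding w_def by (simp add: mult_left_mono mult_right_mono)
  qed auto
  have 3: "AE \<xi> in lborel. (\<lambda>k. w k \<xi> * (cmod (F \<xi>))\<^sup>2) \<longlonglongrightarrow> (cmod (F \<xi>))\<^sup>2"
  proof (rule AE_I2)
    fix \<xi>
    have "(\<lambda>k. w k \<xi> * (cmod (F \<xi>))\<^sup>2) \<longlonglongrightarrow> exp (- 2 * pi\<^sup>2 * 0\<^sup>2 * \<xi>\<^sup>2) * (cmod (F \<xi>))\<^sup>2"
      unfolding w_def by (intro tendsto_intros \<epsilon>_lim)
    then show "(\<lambda>k. w k \<xi> * (cmod (F \<xi>))\<^sup>2) \<longlonglongrightarrow> (cmod (F \<xi>))\<^sup>2" by simp
  qed
  show "integrable lborel (\<lambda>\<xi>. (cmod (F \<xi>))\<^sup>2)"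
    by (rule integrable_monotone_convergence[OF 1 2 3 lim F_meas])
  show "(LINT \<xi>|lborel. (cmod (F \<xi>))\<^sup>2) = (LINT x|lborel. (f x)\<^sup>2)"
    by (rule integral_monotone_convergence[OF 1 2 3 lim F_meas])
qed

section \<open>Signed sums\<close>

abbreviation sign_vectors :: "'a set \<Rightarrow> ('a \<Rightarrow> real) set" where
  "sign_vectors A \<equiv> PiE_dflt A 0 (\<lambda>_. {-1, 1})"

lemma finite_sign_vectors [simp]: "finite A \<Longrightarrow> finite (sign_vectors A)"
  by (rule finite_PiE_dflt) auto

lemma card_sign_vectors: "finite A \<Longrightarrow> card (sign_vectors A) = 2 ^ card A"
  by (subst card_PiE_dflt) (auto simp: numeral_2_eq_2)

text \<open>A sign vector on \<open>insert x A\<close> is a sign at \<open>x\<close> together with a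
  sign vector on \<open>A\<close>. Keeping \<open>g\<close> arbitrary gives one induction step for
  both the characteristic function and the second moment.\<close>

lemma sum_sign_vectors_insert:
  fixes g :: "real \<Rightarrow> 'b::comm_monoid_add"
  assumes "finite A" "x \<notin> A"
  shows "(\<Sum>\<epsilon>\<in>sign_vectors (insert x A). g (\<Sum>i\<in>insert x A. \<epsilon> i * a i)) =
    (\<Sum>\<epsilon>\<in>sign_vectors A. g ((\<Sum>i\<in>A. \<epsilon> i * a i) + a x) + g ((\<Sum>i\<in>A. \<epsilon> i * a i) - a x))"
proof -
  let ?V = "sign_vectors A" and ?X = "\<lambda>\<epsilon>. \<Sum>i\<in>A. \<epsilon> i * a i"
  let ?h = "\<lambda>(y, \<epsilon>). \<epsilon>(x := y :: real)"
  \<comment> \<open>Sign vectors on \<open>A\<close> have the default value 0 at \<open>x\<close>,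
    so no information is lost when that value is overwritten.\<close>
  have inj: "inj_on ?h ({-1, 1} \<times> ?V)"
  proof (rule inj_onI, clarify)
    fix y z \<epsilon> \<delta> assume *: "\<epsilon> \<in> ?V" "\<delta> \<in> ?V" "\<epsilon>(x := y) = \<delta>(x := z)"
    moreover have "\<epsilon> x = 0" "\<delta> x = 0"
      using * assms by (auto simp: PiE_dflt_def)
    ultimately show "y = z \<and> \<epsilon> = \<delta>"
      by (metis fun_upd_same fun_upd_triv fun_upd_upd)
  qed
  have img: "sign_vectors (insert x A) = ?h ` ({-1, 1} \<times> ?V)"
  proof (intro equalityI subsetI)
    fix \<delta> assume *: "\<delta> \<in> sign_vectors (insert x A)"
    have "\<delta> = ?h (\<delta> x, \<delta>(x := 0))" by simp
    moreover have "(\<delta> x, \<delta>(x := 0)) \<in> {-1, 1} \<times> ?V"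
      using * assms by (auto simp: PiE_dflt_def)
    ultimately show "\<delta> \<in> ?h ` ({-1, 1} \<times> ?V)" by (rule image_eqI)
  next
    fix \<delta> assume "\<delta> \<in> ?h ` ({-1, 1} \<times> ?V)"
    then obtain y \<epsilon> where *: "y \<in> {-1, 1}" "\<epsilon> \<in> ?V" and \<delta>: "\<delta> = \<epsilon>(x := y)" by auto
    have "(i \<in> insert x A \<longrightarrow> \<delta> i \<in> {-1, 1}) \<and> (i \<notin> insert x A \<longrightarrow> \<delta> i = 0)" for i
      using * assms unfolding \<delta> PiE_dflt_def by (cases "i = x") auto
    then show "\<delta> \<in> sign_vectors (insert x A)"
      unfolding PiE_dflt_def by blast
  qed
  have upd: "(\<Sum>i\<in>insert x A. (\<epsilon>(x := y)) i * a i) = ?X \<epsilon> + y * a x" for \<epsilon> y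
  proof -
    have "(\<Sum>i\<in>A. (\<epsilon>(x := y)) i * a i) = ?X \<epsilon>"
      using assms by (intro sum.cong) auto
    then show ?thesis using assms by simp
  qed
  have "(\<Sum>\<epsilon>\<in>sign_vectors (insert x A). g (\<Sum>i\<in>insert x A. \<epsilon> i * a i)) =
      (\<Sum>(y, \<epsilon>)\<in>{-1, 1} \<times> ?V. g (?X \<epsilon> + y * a x))"
    unfolding img sum.reindex[OF inj] o_def split_beta upd ..
  also have "\<dots> = (\<Sum>y\<in>{-1, 1}. \<Sum>\<epsilon>\<in>?V. g (?X \<epsilon> + y * a x))"
    by (rule sum.cartesian_product[symmetric])
  also have "\<dots> = (\<Sum>\<epsilon>\<in>?V. g (?X \<epsilon> - a x)) + (\<Sum>\<epsilon>\<in>?V. g (?X \<epsilon> + a x))"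
    by simp
  finally show ?thesis
    by (simp add: sum.distrib add.commute)
qed

text \<open>Each new element contributes the factor cis(t a) + cis(-t a) = 2 cos(t a). Divided by
  2^n, this is the characteristic function of the random signed sum.\<close>

lemma sum_sign_vectors_cis:
  assumes "finite A"
  shows "(\<Sum>\<epsilon>\<in>sign_vectors A. cis (t * (\<Sum>i\<in>A. \<epsilon> i * a i))) =
    of_real (2 ^ card A * (\<Prod>i\<in>A. cos (t * a i)))"
  using assms
proof (induction A rule: finite_induct)
  case empty
  show ?case by (simp add: card_sign_vectors)
next
  case (insert x A)
  have *: "cis (t * (X + a x)) + cis (t * (X - a x)) = of_real (2 * cos (t * a x)) * cis (t * X)" for X
    by (simp add: complex_eq_iff algebra_simps cos_add cos_diff sin_add sin_diff)
  have "(\<Sum>\<epsilon>\<in>sign_vectors (insert x A). cis (t * (\<Sum>i\<in>insert x A. \<epsilon> i * a i))) =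
      of_real (2 * cos (t * a x)) * of_real (2 ^ card A * (\<Prod>i\<in>A. cos (t * a i)))"
    unfolding sum_sign_vectors_insert[OF insert.hyps, where g = "\<lambda>X. cis (t * X)"] *
      sum_distrib_left[symmetric] insert.IH ..
  then show ?case
    using insert.hyps by simp
qed

text \<open>The cross terms of opposite signs cancel. This is the variance needed for Chebyshev's
  inequality.\<close>

lemma sum_sign_vectors_square:
  assumes "finite A"
  shows "(\<Sum>\<epsilon>\<in>sign_vectors A. (\<Sum>i\<in>A. \<epsilon> i * a i)\<^sup>2) = 2 ^ card A * (\<Sum>i\<in>A. (a i)\<^sup>2)"
  using assms
proof (induction A rule: finite_induct)
  case (insert x A)
  have *: "(X + a x)\<^sup>2 + (X - a x)\<^sup>2 = 2 * X\<^sup>2 + 2 * (a x)\<^sup>2" for X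
    by (simp add: power2_eq_square algebra_simps)
  show ?case
    unfolding sum_sign_vectors_insert[OF insert.hyps, where g = "\<lambda>X. X\<^sup>2"] * sum.distrib
      sum_distrib_left[symmetric] insert.IH
    using insert.hyps by (simp add: card_sign_vectors algebra_simps)
qed simp

text \<open>A signed sum is twice the subset sum over its positive positions minus the fixed total,
  so the gap of 1 between subset sums doubles.\<close>

lemma sign_sums_two_separated:
  assumes sep: "one_separated_subset_sums n a"
    and \<epsilon>: "\<epsilon> \<in> sign_vectors {1..n}" and \<delta>: "\<delta> \<in> sign_vectors {1..n}" and neq: "\<epsilon> \<noteq> \<delta>"
  shows "\<bar>(\<Sum>i=1..n. \<epsilon> i * a i) - (\<Sum>i=1..n. \<delta> i * a i)\<bar> \<ge> 2"
proof -
  define pos where "pos \<epsilon> = {i \<in> {1..n}. \<epsilon> i = (1::real)}" for \<epsilon>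
  have sum_eq: "(\<Sum>i=1..n. \<epsilon> i * a i) = 2 * (\<Sum>i\<in>pos \<epsilon>. a i) - (\<Sum>i=1..n. a i)"
    if "\<epsilon> \<in> sign_vectors {1..n}" for \<epsilon>
  proof -
    have "(\<Sum>i=1..n. \<epsilon> i * a i) = (\<Sum>i=1..n. 2 * (if \<epsilon> i = 1 then a i else 0) - a i)"
      using that by (intro sum.cong) (auto simp: PiE_dflt_def)
    also have "\<dots> = 2 * (\<Sum>i=1..n. if \<epsilon> i = 1 then a i else 0) - (\<Sum>i=1..n. a i)"
      by (simp add: sum_subtractf sum_distrib_left)
    also have "(\<Sum>i=1..n. if \<epsilon> i = 1 then a i else 0) = (\<Sum>i\<in>pos \<epsilon>. a i)"
      unfolding pos_def by (rule sum.inter_filter[symmetric]) simp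
    finally show ?thesis .
  qed
  have "pos \<epsilon> \<noteq> pos \<delta>"
  proof
    assume eq: "pos \<epsilon> = pos \<delta>"
    have "\<epsilon> i = \<delta> i" for i
    proof (cases "i \<in> {1..n}")
      case True
      then have "\<epsilon> i = 1 \<longleftrightarrow> \<delta> i = 1" using eq by (auto simp: pos_def set_eq_iff)
      moreover have "\<epsilon> i \<in> {-1, 1}" "\<delta> i \<in> {-1, 1}"
        using True \<epsilon> \<delta> by (auto simp: PiE_dflt_def)
      ultimately show ?thesis by auto
    qed (use \<epsilon> \<delta> in \<open>auto simp: PiE_dflt_def\<close>)
    with neq show False by auto
  qed
  moreover have "pos \<epsilon> \<subseteq> {1..n}" "pos \<delta> \<subseteq> {1..n}"
    by (auto simp: pos_def)
  ultimately have "\<bar>(\<Sum>i\<in>pos \<epsilon>. a i) - (\<Sum>i\<in>pos \<delta>. a i)\<bar> \<ge> 1"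
    using sep unfolding one_separated_subset_sums_def by blast
  then show ?thesis
    unfolding sum_eq[OF \<epsilon>] sum_eq[OF \<delta>] by linarith
qed

text \<open>Packing argument: Chebyshev puts at least three quarters of the 2^n signed sums into an
  interval of length 4 \<sigma>, and 2-separation limits how many fit there. This exponential growth
  of \<sigma> is what brings the final error down to the scale 2^(-n).\<close>

lemma one_separated_subset_sums_std_deviation:
  fixes a :: "nat \<Rightarrow> real"
  assumes sep: "one_separated_subset_sums n a" and "n \<ge> 2"
    and pos: "\<And>i. i \<in> {1..n} \<Longrightarrow> a i > 0"
  shows "sqrt (\<Sum>i=1..n. (a i)\<^sup>2) \<ge> 2 ^ n / 8"
proof -
  define \<sigma> where "\<sigma> = sqrt (\<Sum>i=1..n. (a i)\<^sup>2)"
  let ?V = "sign_vectors {1..n}"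
  define X where "X \<epsilon> = (\<Sum>i=1..n. \<epsilon> i * a i)" for \<epsilon>
  have "(\<Sum>i=1..n. (a i)\<^sup>2) > 0"
    using pos \<open>n \<ge> 2\<close> by (intro sum_pos zero_less_power) auto
  then have \<sigma>: "\<sigma> > 0" and \<sigma>2: "\<sigma>\<^sup>2 = (\<Sum>i=1..n. (a i)\<^sup>2)"
    by (simp_all add: \<sigma>_def)
  define B where "B = {\<epsilon> \<in> ?V. \<bar>X \<epsilon>\<bar> > 2 * \<sigma>}"
  define U where "U = {\<epsilon> \<in> ?V. \<bar>X \<epsilon>\<bar> \<le> 2 * \<sigma>}"
  have "real (card B) * (2 * \<sigma>)\<^sup>2 = (\<Sum>\<epsilon>\<in>B. (2 * \<sigma>)\<^sup>2)"
    by simp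
  also have "\<dots> \<le> (\<Sum>\<epsilon>\<in>B. (X \<epsilon>)\<^sup>2)"
  proof (rule sum_mono)
    fix \<epsilon> assume "\<epsilon> \<in> B"
    then have "(2 * \<sigma>)\<^sup>2 \<le> \<bar>X \<epsilon>\<bar>\<^sup>2"
      using \<sigma> by (intro power_mono) (auto simp: B_def)
    then show "(2 * \<sigma>)\<^sup>2 \<le> (X \<epsilon>)\<^sup>2" by simp
  qed
  also have "\<dots> \<le> (\<Sum>\<epsilon>\<in>?V. (X \<epsilon>)\<^sup>2)"
    by (intro sum_mono2) (auto simp: B_def)
  also have "\<dots> = 2 ^ n * \<sigma>\<^sup>2"
    unfolding X_def by (subst sum_sign_vectors_square) (auto simp: \<sigma>2)
  finally have B: "real (card B) * 4 \<le> 2 ^ n"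
    using \<sigma> by (simp add: power_mult_distrib)
  have "?V = B \<union> U" "B \<inter> U = {}" "finite B" "finite U"
    by (auto simp: B_def U_def)
  then have "card ?V = card B + card U"
    by (simp add: card_Un_disjoint)
  then have "real (card B) + real (card U) = 2 ^ n"
    unfolding card_sign_vectors[OF finite_atLeastAtMost] by (simp flip: of_nat_add)
  with B have U: "3 / 4 * 2 ^ n \<le> real (card U)" by linarith
  \<comment> \<open>Halves of 2-separated numbers are 1-separated, so their floors are distinct
    integers and can be counted.\<close>
  have inj: "inj_on (\<lambda>\<epsilon>. \<lfloor>X \<epsilon> / 2\<rfloor>) U"
  proof (rule inj_onI, rule ccontr)
    fix \<epsilon> \<delta> assume *: "\<epsilon> \<in> U" "\<delta> \<in> U" "\<lfloor>X \<epsilon> / 2\<rfloor> = \<lfloor>X \<delta> / 2\<rfloor>" "\<epsilon> \<noteq> \<delta>"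
    then have "\<bar>X \<epsilon> - X \<delta>\<bar> \<ge> 2"
      unfolding X_def U_def using sign_sums_two_separated[OF sep] by blast
    with *(3) show False by linarith
  qed
  have "(\<lambda>\<epsilon>. \<lfloor>X \<epsilon> / 2\<rfloor>) ` U \<subseteq> {\<lfloor>-\<sigma>\<rfloor>..\<lfloor>\<sigma>\<rfloor>}"
    by (auto simp: U_def abs_le_iff intro!: floor_mono)
  then have "card U \<le> card {\<lfloor>-\<sigma>\<rfloor>..\<lfloor>\<sigma>\<rfloor>}"
    using card_inj_on_le[OF inj] by blast
  then have "real (card U) \<le> real (nat (\<lfloor>\<sigma>\<rfloor> - \<lfloor>-\<sigma>\<rfloor> + 1))"
    by simp
  also have "\<dots> \<le> 2 * \<sigma> + 2"
    using \<sigma> by linarith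
  finally have "3 / 4 * 2 ^ n \<le> 2 * \<sigma> + 2" using U by linarith
  \<comment> \<open>For \<open>n \<ge> 2\<close> the additive 2 of the count is at most half of 2^n;
    what remains is 2^n / 4 \<le> 2 \<sigma>.\<close>
  moreover have "(2::real) ^ 2 \<le> 2 ^ n"
    using \<open>n \<ge> 2\<close> by (intro power_increasing) auto
  ultimately have "2 ^ n / 8 \<le> \<sigma>" by simp
  then show ?thesis by (simp add: \<sigma>_def)
qed

text \<open>Direct integration of the exponential. The centre \<open>y\<close> enters only through a
  phase, so all boxes share the factor sin t / t.\<close>

lemma integral_box_cis:
  assumes "t \<noteq> 0"
  shows "(CLINT x|lborel. (1 / 2 * indicator {y - 1..y + 1} x) *\<^sub>R cis (t * x)) =
    of_real (sin t / t) * cis (t * y)"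
proof -
  have deriv: "((\<lambda>x. - \<i> * cis (t * x) / t) has_vector_derivative cis (t * x)) (at x within A)" for x A
  proof -
    have "((\<lambda>x. cis (t * x)) has_vector_derivative t *\<^sub>R (\<i> * cis (t * x))) (at x within A)"
      unfolding has_vector_derivative_def
      by (auto intro!: derivative_eq_intros simp: scaleR_conv_of_real mult_ac)
    from has_vector_derivative_mult_right[OF this, of "- \<i> / t"] show ?thesis
      using assms by (simp add: scaleR_conv_of_real field_simps)
  qed
  have "(CLINT x|lborel. indicator {y - 1..y + 1} x *\<^sub>R cis (t * x)) =
      - \<i> * cis (t * (y + 1)) / t - (- \<i> * cis (t * (y - 1)) / t)"
    by (rule integral_FTC_atLeastAtMost[OF _ deriv]) (auto intro!: continuous_intros)
  also have "\<dots> = 2 * (of_real (sin t / t) * cis (t * y))"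
    using assms by (simp add: complex_eq_iff field_simps cos_add sin_add cos_diff sin_diff)
  finally have *: "(CLINT x|lborel. indicator {y - 1..y + 1} x *\<^sub>R cis (t * x)) =
      2 * (of_real (sin t / t) * cis (t * y))" .
  have "(CLINT x|lborel. (1 / 2 * indicator {y - 1..y + 1} x) *\<^sub>R cis (t * x)) =
      (1 / 2) *\<^sub>R (CLINT x|lborel. indicator {y - 1..y + 1} x *\<^sub>R cis (t * x))"
    by (subst integral_scaleR_right[symmetric]) simp
  then show ?thesis
    unfolding * by (simp add: scaleR_conv_of_real)
qed

section \<open>Comparison with the Gaussian on the frequency side\<close>

lemma x_cos_le_sin:
  fixes x :: real
  assumes "0 \<le> x" "x \<le> pi"
  shows "x * cos x \<le> sin x"
proof -
  \<comment> \<open>The difference sin x - x cos x has derivative x sin x, which is nonnegative on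
    [0, pi].\<close>
  have "sin 0 - 0 * cos 0 \<le> sin x - x * cos x"
  proof (rule DERIV_nonneg_imp_nondecreasing[OF assms(1)])
    fix y assume "0 \<le> y" "y \<le> x"
    then have "((\<lambda>x. sin x - x * cos x) has_real_derivative y * sin y) (at y) \<and> 0 \<le> y * sin y"
      using assms by (auto intro!: derivative_eq_intros mult_nonneg_nonneg sin_ge_zero)
    then show "\<exists>z. ((\<lambda>x. sin x - x * cos x) has_real_derivative z) (at y) \<and> 0 \<le> z" by blast
  qed
  then show ?thesis by simp
qed

text \<open>By evenness take x \<ge> 0. There cos x * exp(x^2 / 2) starts at 1 and is nonincreasing,
  since the sign of its derivative is that of x cos x - sin x.\<close>

lemma cos_le_exp_neg_half_square:
  fixes x :: real
  assumes "\<bar>x\<bar> \<le> pi / 2"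
  shows "cos x \<le> exp (- x\<^sup>2 / 2)"
proof -
  define y where "y = \<bar>x\<bar>"
  have y: "0 \<le> y" "y \<le> pi / 2" using assms by (auto simp: y_def)
  have "cos y * exp (y\<^sup>2 / 2) \<le> cos 0 * exp (0\<^sup>2 / 2)"
  proof (rule DERIV_nonpos_imp_nonincreasing[OF y(1)])
    fix z assume z: "0 \<le> z" "z \<le> y"
    have "((\<lambda>x. cos x * exp (x\<^sup>2 / 2)) has_real_derivative
        (z * cos z - sin z) * exp (z\<^sup>2 / 2)) (at z)"
      by (auto intro!: derivative_eq_intros simp: algebra_simps)
    moreover have "z * cos z - sin z \<le> 0"
      using x_cos_le_sin[of z] z y by simp
    ultimately show "\<exists>d. ((\<lambda>x. cos x * exp (x\<^sup>2 / 2)) has_real_derivative d) (at z) \<and> d \<le> 0"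
      by (meson exp_ge_zero mult_nonpos_nonneg)
  qed
  then have "cos x * exp (x\<^sup>2 / 2) \<le> 1" by (simp add: y_def)
  then show ?thesis
    by (simp add: exp_minus field_simps)
qed

lemma cos_ge_one_minus_half_square:
  fixes x :: real
  shows "cos x \<ge> 1 - x\<^sup>2 / 2"
proof -
  have "(sin (x / 2))\<^sup>2 \<le> (x / 2)\<^sup>2"
    using abs_sin_x_le_abs_x[of "x / 2"] unfolding abs_le_square_iff .
  then show ?thesis
    using cos_double_sin[of "x / 2"] by (simp add: power_divide)
qed

text \<open>Equivalently, the quadratic times exp x is at least 1. Replacing exp x by its own
  quadratic Taylor polynomial already gives the product 1 + x^4 / 4.\<close>

lemma exp_minus_le_quadratic:
  fixes x :: real
  assumes "x \<ge> 0"
  shows "exp (- x) \<le> 1 - x + x\<^sup>2 / 2"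
proof -
  have q: "1 - x + x\<^sup>2 / 2 \<ge> 0"
    using zero_le_power2[of "x - 1"] by (simp add: power2_eq_square algebra_simps)
  have "1 \<le> (1 - x + x\<^sup>2 / 2) * (1 + x + x\<^sup>2 / 2)"
  proof -
    have "(1 - x + x\<^sup>2 / 2) * (1 + x + x\<^sup>2 / 2) = 1 + (x\<^sup>2 / 2)\<^sup>2"
      by (simp add: field_simps power2_eq_square)
    then show ?thesis by simp
  qed
  also have "\<dots> \<le> (1 - x + x\<^sup>2 / 2) * exp x"
    using exp_lower_Taylor_quadratic[OF assms] q by (intro mult_left_mono) auto
  finally show ?thesis
    by (simp add: exp_minus field_simps)
qed

text \<open>Both functions lie between 1 - x^2 / 2 and 1 - x^2 / 2 + x^4 / 8: their Taylor
  expansions agree up to second order.\<close>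

lemma abs_cos_minus_exp_le:
  fixes x :: real
  assumes "\<bar>x\<bar> \<le> pi / 2"
  shows "\<bar>cos x - exp (- x\<^sup>2 / 2)\<bar> \<le> x ^ 4 / 8"
proof -
  have "exp (- x\<^sup>2 / 2) \<le> 1 - x\<^sup>2 / 2 + x ^ 4 / 8"
    using exp_minus_le_quadratic[of "x\<^sup>2 / 2"] by (simp add: power_divide flip: power_mult)
  then show ?thesis
    using cos_le_exp_neg_half_square[OF assms] cos_ge_one_minus_half_square[of x] by linarith
qed

lemma sinc_bounds:
  fixes x :: real
  assumes "x \<noteq> 0" "\<bar>x\<bar> \<le> pi / 2"
  shows "0 \<le> sin x / x" "sin x / x \<le> 1" "1 - x\<^sup>2 / 2 \<le> sin x / x"
proof -
  define y where "y = \<bar>x\<bar>"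
  have y: "0 < y" "y \<le> pi / 2" using assms by (auto simp: y_def)
  have eq: "sin x / x = sin y / y" by (auto simp: y_def abs_if)
  show "0 \<le> sin x / x" unfolding eq
    using y by (intro divide_nonneg_nonneg sin_ge_zero) auto
  show "sin x / x \<le> 1" unfolding eq
    using y sin_x_le_x[of y] by simp
  \<comment> \<open>The lower bound passes through cos x: sin x / x \<ge> cos x \<ge> 1 - x^2 /
    2.\<close>
  have "y * cos y \<le> sin y"
    using y by (intro x_cos_le_sin) auto
  then have "cos y \<le> sin x / x" unfolding eq
    using y by (simp add: field_simps)
  then show "1 - x\<^sup>2 / 2 \<le> sin x / x"
    using cos_ge_one_minus_half_square[of y] by (simp add: y_def)
qed

section \<open>Products of cosines against the Gaussian in the two frequency ranges\<close>

lemma abs_sin_divide_le_one: "\<bar>sin x / x\<bar> \<le> 1" for x :: real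
  using abs_sin_x_le_abs_x[of x] by (cases "x = 0") (auto simp: divide_le_eq_1)

lemma abs_prod_cos_le_one: "\<bar>\<Prod>i\<in>I. cos (f i :: real)\<bar> \<le> 1"
  by (auto simp: abs_prod intro!: prod_le_1)

lemma prod_cos_gaussian_bounds:
  fixes y :: "'a \<Rightarrow> real"
  assumes "finite I" and y: "\<And>i. i \<in> I \<Longrightarrow> \<bar>y i\<bar> \<le> pi / 2"
  shows "0 \<le> (\<Prod>i\<in>I. cos (y i))"
    and "(\<Prod>i\<in>I. cos (y i)) \<le> exp (- (\<Sum>i\<in>I. (y i)\<^sup>2) / 2)"
    and "\<bar>(\<Prod>i\<in>I. cos (y i)) - exp (- (\<Sum>i\<in>I. (y i)\<^sup>2) / 2)\<bar> \<le> (\<Sum>i\<in>I. y i ^ 4) / 8"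
proof -
  have G: "exp (- (\<Sum>i\<in>I. (y i)\<^sup>2) / 2) = (\<Prod>i\<in>I. exp (- (y i)\<^sup>2 / 2))"
    using assms(1) by (simp add: exp_sum sum_divide_distrib flip: sum_negf)
  have cos0: "0 \<le> cos (y i)" if "i \<in> I" for i
    using y[OF that] by (intro cos_ge_zero) auto
  show "0 \<le> (\<Prod>i\<in>I. cos (y i))" by (intro prod_nonneg cos0)
  show "(\<Prod>i\<in>I. cos (y i)) \<le> exp (- (\<Sum>i\<in>I. (y i)\<^sup>2) / 2)"
    unfolding G by (intro prod_mono conjI cos0 cos_le_exp_neg_half_square y)
  \<comment> \<open>Factors are exchanged one at a time; as all have modulus at most 1, the errors
    simply add up.\<close>
  have "norm ((\<Prod>i\<in>I. cos (y i)) - (\<Prod>i\<in>I. exp (- (y i)\<^sup>2 / 2))) \<le>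
      (\<Sum>i\<in>I. norm (cos (y i) - exp (- (y i)\<^sup>2 / 2)))"
    by (rule norm_prod_diff) auto
  also have "\<dots> \<le> (\<Sum>i\<in>I. y i ^ 4 / 8)"
    using abs_cos_minus_exp_le[OF y] by (intro sum_mono) auto
  finally show "\<bar>(\<Prod>i\<in>I. cos (y i)) - exp (- (\<Sum>i\<in>I. (y i)\<^sup>2) / 2)\<bar> \<le> (\<Sum>i\<in>I. y i ^ 4) / 8"
    unfolding G by (simp add: sum_divide_distrib)
qed

text \<open>Of the two factors in the square, one is bounded by the Gaussian and the other by the
  Taylor error. The product is a Gaussian times a polynomial, hence integrable over the whole
  line.\<close>

lemma low_frequency_bound:
  fixes a :: "'a \<Rightarrow> real"
  assumes "finite I" and a: "\<And>i. i \<in> I \<Longrightarrow> 0 < a i \<and> a i \<le> M"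
    and "M \<ge> 1" "u \<noteq> 0" "M * \<bar>u\<bar> \<le> pi / 2"
  defines "s \<equiv> \<Sum>i\<in>I. (a i)\<^sup>2"
  shows "(sin u / u * (\<Prod>i\<in>I. cos (u * a i)) - exp (- s * u\<^sup>2 / 2))\<^sup>2 \<le>
    exp (- s * u\<^sup>2 / 2) * (M\<^sup>2 * (s * u ^ 4 / 8 + 2 * u\<^sup>2))"
proof -
  define S where "S = sin u / u"
  define P where "P = (\<Prod>i\<in>I. cos (u * a i))"
  define G where "G = exp (- s * u\<^sup>2 / 2)"
  have small: "\<bar>u * a i\<bar> \<le> pi / 2" if "i \<in> I" for i
  proof -
    have "\<bar>u\<bar> * a i \<le> \<bar>u\<bar> * M" using a[OF that] by (intro mult_left_mono) auto
    then show ?thesis using a[OF that] assms(5) by (simp add: abs_mult mult.commute)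
  qed
  have squares: "(\<Sum>i\<in>I. (u * a i)\<^sup>2) = s * u\<^sup>2"
    unfolding s_def power_mult_distrib sum_distrib_right by (simp add: mult.commute)
  have "(\<Sum>i\<in>I. (u * a i) ^ 4) = u ^ 4 * (\<Sum>i\<in>I. (a i)\<^sup>2 * (a i)\<^sup>2)"
    by (simp add: power_mult_distrib sum_distrib_left flip: power_add)
  \<comment> \<open>Only two of the four powers are estimated by \<open>M\<close>, which leaves a
    single factor \<open>s\<close>.\<close>
  also have "\<dots> \<le> u ^ 4 * (\<Sum>i\<in>I. M\<^sup>2 * (a i)\<^sup>2)"
    using a by (intro mult_left_mono sum_mono mult_right_mono power_mono) (auto simp: less_imp_le)
  finally have quartic: "(\<Sum>i\<in>I. (u * a i) ^ 4) \<le> u ^ 4 * M\<^sup>2 * s"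
    by (simp add: s_def sum_distrib_left mult.assoc)
  note P_bounds = prod_cos_gaussian_bounds[OF assms(1), of "\<lambda>i. u * a i", OF small, unfolded squares]
  have P: "0 \<le> P" "P \<le> G" "\<bar>P - G\<bar> \<le> u ^ 4 * M\<^sup>2 * s / 8"
    using P_bounds quartic by (simp_all add: P_def G_def)
  have "1 * \<bar>u\<bar> \<le> M * \<bar>u\<bar>"
    using \<open>M \<ge> 1\<close> by (intro mult_right_mono) auto
  then have "\<bar>u\<bar> \<le> pi / 2" using assms(5) by simp
  note S = sinc_bounds[OF \<open>u \<noteq> 0\<close> this, folded S_def]
  have "s \<ge> 0" unfolding s_def by (intro sum_nonneg) auto
  then have G: "0 \<le> G" "G \<le> 1" by (auto simp: G_def)
  have "0 \<le> S * P" "S * P \<le> G"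
    using S P mult_mono[of S 1 P G] by auto
  then have 1: "\<bar>S * P - G\<bar> \<le> G" by linarith
  \<comment> \<open>This separates the error of the cosine product from the error of sin u /
    u.\<close>
  have "S * P - G = S * (P - G) - (1 - S) * G" by (simp add: algebra_simps)
  then have "\<bar>S * P - G\<bar> \<le> \<bar>S * (P - G)\<bar> + \<bar>(1 - S) * G\<bar>" by linarith
  also have "\<bar>S * (P - G)\<bar> \<le> 1 * (u ^ 4 * M\<^sup>2 * s / 8)"
    unfolding abs_mult using S P by (intro mult_mono) auto
  also have "\<bar>(1 - S) * G\<bar> \<le> u\<^sup>2 / 2 * 1"
    unfolding abs_mult using S G by (intro mult_mono) auto
  \<comment> \<open>The generous coefficient 2 lets the same majorant absorb the constant 3 that
    arises at high frequencies.\<close>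
  also have "u\<^sup>2 / 2 * 1 \<le> M\<^sup>2 * (2 * u\<^sup>2)"
  proof -
    have "1 * (u\<^sup>2 / 2) \<le> M\<^sup>2 * (2 * u\<^sup>2)"
      using \<open>M \<ge> 1\<close> by (intro mult_mono) auto
    then show ?thesis by simp
  qed
  finally have 2: "\<bar>S * P - G\<bar> \<le> M\<^sup>2 * (s * u ^ 4 / 8 + 2 * u\<^sup>2)"
    by (simp add: algebra_simps)
  have "(S * P - G)\<^sup>2 = \<bar>S * P - G\<bar> * \<bar>S * P - G\<bar>"
    by (simp add: power2_eq_square)
  also have "\<dots> \<le> G * (M\<^sup>2 * (s * u ^ 4 / 8 + 2 * u\<^sup>2))"
    using 1 2 G by (intro mult_mono) auto
  finally show ?thesis by (simp add: S_def P_def G_def)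
qed

text \<open>Expanding the square leaves G (G - 2y), of modulus at most 3 G. Since M |u| \<ge> pi / 2
  > 3/2, the polynomial of the low frequency bound exceeds 3, so one majorant covers both
  ranges.\<close>

lemma high_frequency_bound:
  fixes y s :: real
  assumes "\<bar>y\<bar> \<le> 1" "s \<ge> 0" "M * \<bar>u\<bar> \<ge> pi / 2"
  shows "\<bar>(y - exp (- s * u\<^sup>2 / 2))\<^sup>2 - y\<^sup>2\<bar> \<le>
    exp (- s * u\<^sup>2 / 2) * (M\<^sup>2 * (s * u ^ 4 / 8 + 2 * u\<^sup>2))"
proof -
  define G where "G = exp (- s * u\<^sup>2 / 2)"
  have G: "0 \<le> G" "G \<le> 1" using assms(2) by (auto simp: G_def)
  have "(y - G)\<^sup>2 - y\<^sup>2 = G * (G - 2 * y)"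
    by (simp add: power2_eq_square algebra_simps)
  then have "\<bar>(y - G)\<^sup>2 - y\<^sup>2\<bar> = G * \<bar>G - 2 * y\<bar>"
    using G by (simp add: abs_mult)
  also have "\<dots> \<le> G * 3"
    using G assms(1) by (intro mult_left_mono) auto
  also have "3 \<le> M\<^sup>2 * (s * u ^ 4 / 8 + 2 * u\<^sup>2)"
  proof -
    have "3 / 2 \<le> M * \<bar>u\<bar>" using assms(3) pi_gt3 by linarith
    then have "(3 / 2)\<^sup>2 \<le> (M * \<bar>u\<bar>)\<^sup>2" by (intro power_mono) auto
    then have "9 / 4 \<le> M\<^sup>2 * u\<^sup>2" by (simp add: power_mult_distrib power_divide)
    then have "3 \<le> M\<^sup>2 * (2 * u\<^sup>2)" by simp
    also have "\<dots> \<le> M\<^sup>2 * (s * u ^ 4 / 8 + 2 * u\<^sup>2)"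
      using assms(2) by (intro mult_left_mono) auto
    finally show ?thesis .
  qed
  finally show ?thesis using G by (simp add: G_def mult_left_mono)
qed

text \<open>Here \<open>H\<close> is the common majorant of both ranges after substituting u = 2 pi
  x. Its integral needs only the second and fourth moments of a normal density of standard deviation
  1 / (2 pi \<sigma>).\<close>

lemma integral_gaussian_weight_moments:
  fixes M :: real
  assumes "\<sigma> > 0"
  defines "G \<equiv> \<lambda>x. exp (- \<sigma>\<^sup>2 * (2 * pi * x)\<^sup>2 / 2)"
  defines "H \<equiv> \<lambda>M x. G x * (M\<^sup>2 * (\<sigma>\<^sup>2 * (2 * pi * x) ^ 4 / 8 + 2 * (2 * pi * x)\<^sup>2))"
  shows "integrable lborel (H M)" and "(LINT x|lborel. H M x) \<le> M\<^sup>2 / \<sigma> ^ 3"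
proof -
  define \<tau> where "\<tau> = 1 / (2 * pi * \<sigma>)"
  have \<tau>: "\<tau> > 0" using assms(1) by (simp add: \<tau>_def)
  have G: "G x = 1 / (sqrt (2 * pi) * \<sigma>) * normal_density 0 \<tau> x" for x
    using gaussian_weight_eq_normal_density[OF assms(1), of x]
    by (simp add: G_def \<tau>_def power_mult_distrib mult_ac)
  have H: "H M = (\<lambda>x. M\<^sup>2 / (sqrt (2 * pi) * \<sigma>) * (\<sigma>\<^sup>2 * (2 * pi) ^ 4 / 8 * (normal_density 0 \<tau> x * x ^ 4) +
      2 * (2 * pi)\<^sup>2 * (normal_density 0 \<tau> x * x\<^sup>2)))"
    by (rule ext) (simp add: H_def G power_mult_distrib algebra_simps add_divide_distrib)
  have int: "integrable lborel (\<lambda>x. normal_density 0 \<tau> x * x ^ k)" for k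
    using integrable_normal_moment[OF \<tau>, of 0 k] by simp
  show "integrable lborel (H M)"
    unfolding H by (intro integrable_mult_right Bochner_Integration.integrable_add int)
  have m2: "(LINT x|lborel. normal_density 0 \<tau> x * x\<^sup>2) = \<tau>\<^sup>2"
    using integral_normal_moment_even[OF \<tau>, of 0 1] by (simp add: fact_numeral)
  have m4: "(LINT x|lborel. normal_density 0 \<tau> x * x ^ 4) = 3 * \<tau> ^ 4"
    using integral_normal_moment_even[OF \<tau>, of 0 2] by (simp add: fact_numeral power_divide flip: power_mult)
  have "(LINT x|lborel. H M x) = M\<^sup>2 / (sqrt (2 * pi) * \<sigma>) *
      (\<sigma>\<^sup>2 * (2 * pi) ^ 4 / 8 * (3 * \<tau> ^ 4) + 2 * (2 * pi)\<^sup>2 * \<tau>\<^sup>2)"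
    unfolding H using int by (simp add: m2 m4)
  \<comment> \<open>The fourth moment contributes 3/8 and the second moment 2; their sum 19/8 is
    below sqrt(2 pi), so the final constant is 1.\<close>
  also have "\<sigma>\<^sup>2 * (2 * pi) ^ 4 / 8 * (3 * \<tau> ^ 4) + 2 * (2 * pi)\<^sup>2 * \<tau>\<^sup>2 = 19 / 8 / \<sigma>\<^sup>2"
    using assms(1) by (simp add: \<tau>_def power_divide power_mult_distrib field_simps flip: power_add)
  also have "M\<^sup>2 / (sqrt (2 * pi) * \<sigma>) * (19 / 8 / \<sigma>\<^sup>2) = M\<^sup>2 / \<sigma> ^ 3 * (19 / 8 / sqrt (2 * pi))"
    by (simp add: power2_eq_square power3_eq_cube)
  also have "\<dots> \<le> M\<^sup>2 / \<sigma> ^ 3 * 1"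
  proof (rule mult_left_mono)
    have "(19 / 8)\<^sup>2 \<le> 2 * pi" using pi_gt3 by (simp add: power2_eq_square)
    then have "19 / 8 \<le> sqrt (2 * pi)" by (rule real_le_rsqrt)
    then show "19 / 8 / sqrt (2 * pi) \<le> 1" by simp
    show "0 \<le> M\<^sup>2 / \<sigma> ^ 3" using assms(1) by simp
  qed
  finally show "(LINT x|lborel. H M x) \<le> M\<^sup>2 / \<sigma> ^ 3" by simp
qed

section \<open>The mean square distance of the densities\<close>

definition variance_sum :: "nat \<Rightarrow> (nat \<Rightarrow> real) \<Rightarrow> real" where
  "variance_sum n a = (\<Sum>i=1..n. (a i)\<^sup>2)"

definition density_error :: "nat \<Rightarrow> (nat \<Rightarrow> real) \<Rightarrow> real \<Rightarrow> real" where
  "density_error n a x = convolve_pmf box_kernel (sign_sum_distr n a) x - gaussian_approx n a x"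

context
  fixes n :: nat and a :: "nat \<Rightarrow> real"
  assumes n: "n > 0" and pos: "\<And>i. i \<in> {1..n} \<Longrightarrow> a i > 0"
begin

lemma variance_sum_pos: "variance_sum n a > 0"
  unfolding variance_sum_def using pos n by (intro sum_pos zero_less_power) auto

section \<open>Regularity and Fourier transform of the difference of the densities\<close>

lemma convolve_box_kernel_eq:
  "convolve_pmf box_kernel (sign_sum_distr n a) x =
    (\<Sum>\<epsilon>\<in>sign_vectors {1..n}. 1 / 2 ^ n *
      (1 / 2 * indicator {(\<Sum>i=1..n. \<epsilon> i * a i) - 1..(\<Sum>i=1..n. \<epsilon> i * a i) + 1} x))"
  unfolding convolve_box_kernel_sign_sum_distr sum_distrib_left ..

lemma integrable_box: "integrable lborel (\<lambda>x. 1 / 2 * indicator {y - 1..y + 1 :: real} x :: real)"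
  by (intro integrable_mult_right integrable_real_indicator) auto

lemma integrable_convolve_box_kernel:
  "integrable lborel (convolve_pmf box_kernel (sign_sum_distr n a))"
  unfolding convolve_box_kernel_eq
  by (intro Bochner_Integration.integrable_sum integrable_mult_right integrable_box)

lemma integrable_gaussian_approx: "integrable lborel (gaussian_approx n a)"
  using variance_sum_pos unfolding gaussian_approx_def variance_sum_def by simp

lemma integrable_density_error: "integrable lborel (density_error n a)"
  unfolding density_error_def[abs_def]
  by (intro Bochner_Integration.integrable_diff integrable_convolve_box_kernel integrable_gaussian_approx)

text \<open>Parseval asks only for some bound, so overlaps of boxes are estimated crudely: each of
  the 2^n terms is at most 1 / 2^n.\<close>

lemma density_error_bounded: "\<bar>density_error n a x\<bar> \<le> 1 + gaussian_approx n a 0"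
proof -
  have "0 \<le> convolve_pmf box_kernel (sign_sum_distr n a) x"
    unfolding convolve_box_kernel_eq by (intro sum_nonneg) auto
  moreover have "convolve_pmf box_kernel (sign_sum_distr n a) x \<le>
      (\<Sum>\<epsilon>\<in>sign_vectors {1..n}. 1 / 2 ^ n)"
    unfolding convolve_box_kernel_eq by (intro sum_mono) (auto simp: indicator_def field_simps)
  then have "convolve_pmf box_kernel (sign_sum_distr n a) x \<le> 1"
    by (simp add: card_sign_vectors)
  moreover have "0 \<le> gaussian_approx n a x" "gaussian_approx n a x \<le> gaussian_approx n a 0"
    unfolding gaussian_approx_def normal_density_def by (auto intro!: divide_right_mono)
  ultimately show ?thesis
    unfolding density_error_def by linarith
qed

text \<open>Jumps can occur only at the endpoints of the finitely many boxes, and these form a null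
  set.\<close>

lemma AE_isCont_density_error: "AE x in lborel. isCont (density_error n a) x"
proof -
  let ?X = "\<lambda>\<epsilon>. \<Sum>i=1..n. \<epsilon> i * a i"
  let ?J = "(\<lambda>\<epsilon>. ?X \<epsilon> - 1) ` sign_vectors {1..n} \<union> (\<lambda>\<epsilon>. ?X \<epsilon> + 1) ` sign_vectors {1..n}"
  have "AE x in lborel. x \<notin> ?J"
    by (intro AE_not_in countable_imp_null_set_lborel countable_finite) simp
  then show ?thesis
  proof eventually_elim
    case (elim x)
    have box: "isCont (indicator {?X \<epsilon> - 1..?X \<epsilon> + 1} :: real \<Rightarrow> real) x" if "\<epsilon> \<in> sign_vectors {1..n}" for \<epsilon>
    proof -
      have "x \<noteq> ?X \<epsilon> - 1" "x \<noteq> ?X \<epsilon> + 1" using elim that by auto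
      then have "x \<notin> frontier {?X \<epsilon> - 1..?X \<epsilon> + 1}"
        by (auto simp only: frontier_def closure_closed[OF closed_atLeastAtMost] interior_atLeastAtMost_real
            Diff_iff atLeastAtMost_iff greaterThanLessThan_iff less_le)
      then show ?thesis by (rule isCont_indicator[THEN iffD2])
    qed
    have "isCont (\<lambda>x. \<Sum>\<epsilon>\<in>sign_vectors {1..n}. 1 / 2 ^ n *
        (1 / 2 * indicator {?X \<epsilon> - 1..?X \<epsilon> + 1} x) :: real) x"
      by (intro isCont_sum continuous_mult continuous_const box ballI)
    moreover have "isCont (normal_density 0 \<sigma>) x" if "\<sigma> > 0" for \<sigma>
      unfolding normal_density_def using that by (intro continuous_intros) auto
    ultimately show ?case
      using variance_sum_pos
      unfolding density_error_def[abs_def] convolve_box_kernel_eq gaussian_approx_def variance_sum_def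
      by (intro continuous_diff) auto
  qed
qed

text \<open>By linearity: the boxes give sin t / t times phases, and the phases average to the
  product of cosines. The formula fails at \<xi> = 0, where division by zero yields 0 in place of
  the limit 1.\<close>

lemma fourier_density_error:
  assumes "\<xi> \<noteq> 0"
  shows "(CLINT x|lborel. density_error n a x *\<^sub>R cis (2 * pi * \<xi> * x)) =
    of_real (sin (2 * pi * \<xi>) / (2 * pi * \<xi>) * (\<Prod>i=1..n. cos (2 * pi * \<xi> * a i)) -
      exp (- variance_sum n a * (2 * pi * \<xi>)\<^sup>2 / 2))"
proof -
  define t where "t = 2 * pi * \<xi>"
  have t: "t \<noteq> 0" using assms by (simp add: t_def)
  let ?V = "sign_vectors {1..n}" and ?X = "\<lambda>\<epsilon>. \<Sum>i=1..n. \<epsilon> i * a i"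
  let ?b = "\<lambda>\<epsilon> x. 1 / 2 * indicator {?X \<epsilon> - 1..?X \<epsilon> + 1} x :: real"
  have int_box: "integrable lborel (\<lambda>x. ?b \<epsilon> x *\<^sub>R cis (t * x))" for \<epsilon>
    by (intro integrable_scaleR_cis integrable_box) auto
  have "(CLINT x|lborel. convolve_pmf box_kernel (sign_sum_distr n a) x *\<^sub>R cis (t * x)) =
      (CLINT x|lborel. \<Sum>\<epsilon>\<in>?V. (1 / 2 ^ n) *\<^sub>R (?b \<epsilon> x *\<^sub>R cis (t * x)))"
    unfolding convolve_box_kernel_eq scaleR_sum_left scaleR_scaleR ..
  also have "\<dots> = (\<Sum>\<epsilon>\<in>?V. (1 / 2 ^ n) *\<^sub>R (CLINT x|lborel. ?b \<epsilon> x *\<^sub>R cis (t * x)))"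
    by (subst Bochner_Integration.integral_sum)
       (intro integrable_scaleR_right int_box, simp only: integral_scaleR_right)
  also have "\<dots> = (\<Sum>\<epsilon>\<in>?V. (1 / 2 ^ n) *\<^sub>R (of_real (sin t / t) * cis (t * ?X \<epsilon>)))"
    unfolding integral_box_cis[OF t] ..
  also have "\<dots> = of_real (1 / 2 ^ n * (sin t / t)) * (\<Sum>\<epsilon>\<in>?V. cis (t * ?X \<epsilon>))"
    unfolding scaleR_conv_of_real sum_distrib_left of_real_mult by (simp only: mult.assoc)
  also have "\<dots> = of_real (1 / 2 ^ n * (sin t / t) * (2 ^ n * (\<Prod>i=1..n. cos (t * a i))))"
    unfolding sum_sign_vectors_cis[OF finite_atLeastAtMost] by (simp only: of_real_mult card_atLeastAtMost diff_Suc_1)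
  also have "1 / 2 ^ n * (sin t / t) * (2 ^ n * (\<Prod>i=1..n. cos (t * a i))) =
      sin t / t * (\<Prod>i=1..n. cos (t * a i))"
    by simp
  finally have conv: "(CLINT x|lborel. convolve_pmf box_kernel (sign_sum_distr n a) x *\<^sub>R cis (t * x)) =
      of_real (sin t / t * (\<Prod>i=1..n. cos (t * a i)))" .
  have gauss: "(CLINT x|lborel. gaussian_approx n a x *\<^sub>R cis (t * x)) =
      of_real (exp (- variance_sum n a * t\<^sup>2 / 2))"
    using variance_sum_pos unfolding gaussian_approx_def variance_sum_def[symmetric]
    by (subst integral_normal_density_cis) (auto simp: power_mult_distrib)
  have "(CLINT x|lborel. density_error n a x *\<^sub>R cis (t * x)) =
      (CLINT x|lborel. convolve_pmf box_kernel (sign_sum_distr n a) x *\<^sub>R cis (t * x)) -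
      (CLINT x|lborel. gaussian_approx n a x *\<^sub>R cis (t * x))"
    unfolding density_error_def scaleR_left_diff_distrib
    by (intro Bochner_Integration.integral_diff integrable_scaleR_cis
          integrable_convolve_box_kernel integrable_gaussian_approx) auto
  then show ?thesis
    unfolding conv gauss by (simp add: t_def)
qed

text \<open>Parseval turns the first integral into one over frequencies. There the integrands differ
  by at most the Gaussian majorant on both sides of the cutoff, so a single moment computation
  bounds the total error.\<close>

lemma L2_error_minus_high_frequencies:
  assumes M: "\<And>i. i \<in> {1..n} \<Longrightarrow> a i \<le> M" and "M \<ge> 1"
  shows "\<bar>(LINT x|lborel. (density_error n a x)\<^sup>2) -
      (LINT x:{x. \<bar>x\<bar> \<ge> 1 / (4 * M)}|lborel.
        (sin (2 * pi * x) / (2 * pi * x))\<^sup>2 * (\<Prod>i=1..n. (cos (2 * pi * a i * x))\<^sup>2))\<bar>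
    \<le> M\<^sup>2 / sqrt (variance_sum n a) ^ 3"
proof -
  define T where "T x = sin (2 * pi * x) / (2 * pi * x) * (\<Prod>i=1..n. cos (2 * pi * x * a i))" for x
  define G where "G x = exp (- variance_sum n a * (2 * pi * x)\<^sup>2 / 2)" for x
  define H where "H = (\<lambda>x. G x * (M\<^sup>2 * (variance_sum n a * (2 * pi * x) ^ 4 / 8 + 2 * (2 * pi * x)\<^sup>2)))"
  define F where "F \<xi> = (CLINT x|lborel. density_error n a x *\<^sub>R cis (2 * pi * \<xi> * x))" for \<xi>
  define Q where "Q x = indicator {x. \<bar>x\<bar> \<ge> 1 / (4 * M)} x * (T x)\<^sup>2" for x
  have "(sqrt (variance_sum n a))\<^sup>2 = variance_sum n a" "sqrt (variance_sum n a) > 0"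
    using variance_sum_pos by auto
  note moments = integral_gaussian_weight_moments[OF this(2), of M, unfolded this(1)]
  have H_int: "integrable lborel H" and H_le: "(LINT x|lborel. H x) \<le> M\<^sup>2 / sqrt (variance_sum n a) ^ 3"
    unfolding H_def G_def by (rule moments)+
  note F_int = Parseval_integrable[OF integrable_density_error density_error_bounded AE_isCont_density_error,
      folded F_def]
  note F_eq = Parseval[OF integrable_density_error density_error_bounded AE_isCont_density_error,
      folded F_def]
  have T_meas[measurable]: "T \<in> borel_measurable borel"
    unfolding T_def by measurable
  have Q_meas[measurable]: "Q \<in> borel_measurable borel"
    unfolding Q_def by measurable
  have pointwise: "\<bar>(cmod (F x))\<^sup>2 - Q x\<bar> \<le> H x" if "x \<noteq> 0" for x
  proof -
    have F: "(cmod (F x))\<^sup>2 = (T x - G x)\<^sup>2"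
      unfolding F_def fourier_density_error[OF that] T_def G_def norm_of_real by simp
    have scale: "M * \<bar>2 * pi * x\<bar> = 2 * pi * (M * \<bar>x\<bar>)"
      by (simp add: abs_mult)
    \<comment> \<open>With u = 2 pi x, the cutoff is exactly the condition M |u| \<ge> pi / 2 that
      separates the two pointwise bounds.\<close>
    have cutoff: "\<bar>x\<bar> \<ge> 1 / (4 * M) \<longleftrightarrow> M * \<bar>x\<bar> \<ge> 1 / 4"
      using \<open>M \<ge> 1\<close> by (simp add: field_simps)
    show ?thesis
    proof (cases "\<bar>x\<bar> \<ge> 1 / (4 * M)")
      case True
      have "\<bar>T x\<bar> \<le> 1 * 1"
        unfolding T_def abs_mult
        by (intro mult_mono abs_sin_divide_le_one abs_prod_cos_le_one) auto
      then have T: "\<bar>T x\<bar> \<le> 1" by simp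
      have "2 * pi * (1 / 4) \<le> 2 * pi * (M * \<bar>x\<bar>)"
        using True unfolding cutoff by (intro mult_left_mono) auto
      then have "\<bar>(T x - G x)\<^sup>2 - (T x)\<^sup>2\<bar> \<le> H x"
        unfolding G_def H_def
        using T variance_sum_pos by (intro high_frequency_bound) (simp_all add: scale)
      then show ?thesis using True by (simp add: F Q_def)
    next
      case False
      have "2 * pi * (M * \<bar>x\<bar>) \<le> 2 * pi * (1 / 4)"
        using False unfolding cutoff by (intro mult_left_mono) auto
      then have "(T x - G x)\<^sup>2 \<le> H x"
        unfolding T_def G_def H_def variance_sum_def
        using \<open>M \<ge> 1\<close> that pos M by (intro low_frequency_bound) (simp_all add: scale)
      then show ?thesis using False by (simp add: F Q_def)
    qed
  qed
  have AE: "AE x in lborel. \<bar>(cmod (F x))\<^sup>2 - Q x\<bar> \<le> H x"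
    using AE_lborel_singleton[of "0::real"] by eventually_elim (rule pointwise)
  have F_meas: "(\<lambda>\<xi>. (cmod (F \<xi>))\<^sup>2) \<in> borel_measurable lborel"
    using F_int by (rule borel_measurable_integrable)
  have diff_int: "integrable lborel (\<lambda>x. (cmod (F x))\<^sup>2 - Q x)"
    by (rule Bochner_Integration.integrable_bound[OF H_int])
       (use AE F_meas in \<open>auto elim!: eventually_mono\<close>)
  \<comment> \<open>Integrability of the high frequency part comes indirectly, from that of |F|^2
    and of the dominated difference.\<close>
  have Q_int: "integrable lborel Q"
    using Bochner_Integration.integrable_diff[OF F_int diff_int] by simp
  have "\<bar>(LINT x|lborel. (cmod (F x))\<^sup>2) - (LINT x|lborel. Q x)\<bar> = \<bar>LINT x|lborel. (cmod (F x))\<^sup>2 - Q x\<bar>"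
    using F_int Q_int by simp
  also have "\<dots> \<le> (LINT x|lborel. \<bar>(cmod (F x))\<^sup>2 - Q x\<bar>)"
    by (rule integral_abs_bound)
  also have "\<dots> \<le> (LINT x|lborel. H x)"
    using AE diff_int H_int by (intro integral_mono_AE) auto
  also note H_le
  also have "(LINT x|lborel. Q x) = (LINT x:{x. \<bar>x\<bar> \<ge> 1 / (4 * M)}|lborel.
      (sin (2 * pi * x) / (2 * pi * x))\<^sup>2 * (\<Prod>i=1..n. (cos (2 * pi * a i * x))\<^sup>2))"
    unfolding set_lebesgue_integral_def Q_def T_def real_scaleR_def power_mult_distrib[symmetric]
      prod_power_distrib[symmetric]
    by (simp add: mult_ac)
  finally show ?thesis unfolding F_eq .
qed

end

section \<open>From the explicit error bound to the asymptotic statement\<close>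

theorem theorem2:
  fixes c :: real
  assumes "c > 0"
  shows "\<forall>\<eta>>0. \<exists>N. \<forall>n\<ge>N. \<forall>a :: nat \<Rightarrow> real.
    (\<forall>i\<in>{1..n}. a i > 0) \<longrightarrow>
    (\<forall>i\<in>{1..n}. a i \<le> a n) \<longrightarrow>
    one_separated_subset_sums n a \<longrightarrow>
    (a n)\<^sup>2 \<le> c * real n powr (-1 / 2) * (\<Sum>i=1..n. (a i)\<^sup>2) \<longrightarrow>
    \<bar>(LINT x|lborel. (convolve_pmf box_kernel (sign_sum_distr n a) x - gaussian_approx n a x)\<^sup>2) -
      (LINT x:{x. \<bar>x\<bar> \<ge> 1 / (4 * a n)}|lborel.
        (sin (2 * pi * x) / (2 * pi * x))\<^sup>2 * (\<Prod>i=1..n. (cos (2 * pi * a i * x))\<^sup>2))\<bar>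
    \<le> \<eta> * 2 powr (- real n)"
proof (intro allI impI, goal_cases)
  case (1 \<eta>)
  then have \<eta>: "\<eta> > 0" .
  \<comment> \<open>The error will be at most (c / sqrt n) * (8 / 2^n), which calls for sqrt n \<ge>
    8 c / \<eta>. The later shift to \<open>N + 2\<close> secures \<open>n \<ge> 2\<close> for the
    bound on \<sigma>.\<close>
  obtain N :: nat where N: "(8 * c / \<eta>)\<^sup>2 \<le> real N"
    using real_arch_simple ..
  show ?case
  proof (rule exI[of _ "N + 2"], intro allI impI, goal_cases)
    case (1 n a)
    note n = 1(1) and pos = 1(2) and max = 1(3) and sep = 1(4) and le = 1(5)
    define \<sigma> where "\<sigma> = sqrt (\<Sum>i=1..n. (a i)\<^sup>2)"
    have "n \<ge> 2" and "(8 * c / \<eta>)\<^sup>2 \<le> n"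
      using n N by linarith+
    then have sqrt_n: "8 * c / \<eta> \<le> sqrt n"
      by (intro real_le_rsqrt)
    have \<sigma>_ge: "\<sigma> \<ge> 2 ^ n / 8"
      unfolding \<sigma>_def using sep \<open>n \<ge> 2\<close> pos
      by (intro one_separated_subset_sums_std_deviation) blast+
    then have \<sigma>: "\<sigma> > 0"
      by (rule less_le_trans[rotated]) simp
    have "a n \<ge> 1"
    proof -
      \<comment> \<open>Comparing a singleton with the empty set shows that every element is at
        least 1.\<close>
      have "\<bar>(\<Sum>i\<in>{n}. a i) - (\<Sum>i\<in>{}. a i)\<bar> \<ge> 1"
        using sep[unfolded one_separated_subset_sums_def, rule_format, of "{n}" "{}"] \<open>n \<ge> 2\<close>
        by simp
      moreover have "a n > 0" using pos \<open>n \<ge> 2\<close> by auto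
      ultimately show ?thesis by simp
    qed
    have "\<bar>(LINT x|lborel. (convolve_pmf box_kernel (sign_sum_distr n a) x - gaussian_approx n a x)\<^sup>2) -
        (LINT x:{x. \<bar>x\<bar> \<ge> 1 / (4 * a n)}|lborel.
          (sin (2 * pi * x) / (2 * pi * x))\<^sup>2 * (\<Prod>i=1..n. (cos (2 * pi * a i * x))\<^sup>2))\<bar> \<le> (a n)\<^sup>2 / \<sigma> ^ 3"
      unfolding \<sigma>_def variance_sum_def[symmetric] density_error_def[symmetric]
      using pos max \<open>n \<ge> 2\<close> \<open>a n \<ge> 1\<close> by (intro L2_error_minus_high_frequencies) auto
    \<comment> \<open>The growth hypothesis trades the square of the largest element for \<sigma>^2,
      leaving a single factor 1 / \<sigma>.\<close>
    also have "\<dots> \<le> (c / sqrt n * \<sigma>\<^sup>2) / \<sigma> ^ 3"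
    proof (rule divide_right_mono)
      have "\<sigma>\<^sup>2 = (\<Sum>i=1..n. (a i)\<^sup>2)"
        unfolding \<sigma>_def by (intro real_sqrt_pow2 sum_nonneg) auto
      then show "(a n)\<^sup>2 \<le> c / sqrt n * \<sigma>\<^sup>2"
        using le powr_minus_divide[of "real n" "1 / 2"] by (simp add: powr_half_sqrt)
    qed (use \<sigma> in auto)
    also have "\<dots> = c / sqrt n * (1 / \<sigma>)"
      using \<sigma> by (simp add: power2_eq_square power3_eq_cube)
    also have "\<dots> \<le> \<eta> / 8 * (8 / 2 ^ n)"
    proof (rule mult_mono)
      show "c / sqrt n \<le> \<eta> / 8"
        using sqrt_n \<eta> \<open>n \<ge> 2\<close> by (simp add: field_simps)
      have "1 / \<sigma> \<le> 1 / (2 ^ n / 8)"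
        using \<sigma>_ge by (intro frac_le) auto
      then show "1 / \<sigma> \<le> 8 / 2 ^ n" by simp
    qed (use \<eta> \<sigma> in auto)
    also have "\<dots> = \<eta> * 2 powr (- real n)"
      by (simp add: powr_minus_divide powr_realpow)
    finally show ?case .
  qed
qed

end
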